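(* Let $(X,\tau)$ be an Alexandroff space, let $f:X\to X$ be a continuous self-map, and let $x\in X$. Let $V(x)$ denote the intersection of all open sets containing $x$. Then: (i) If there exists $k\in\mathbb{Z}^+$ such that $f^k(x)\in V(x)$, then $x$ is a quasi-periodic point of $f$. (ii) If there exists $k\in\mathbb{Z}^+$ such that $f^k(x)\in V(x)$, and $V(x)$ is finite, then $x$ is an eventually periodic point of $f$. (iii) If $x$ is a recurrent point of $f$, then it is a quasi-periodic point of $f$. (iv) If $x$ is a recurrent point of $f$ and $V(x)$ is finite, then it is an eventually periodic point of $f$.
   Context: $\mathbb{N}$ is the set of non-negative integers and $\mathbb{Z}^+$ the set of positive integers. A topological space is an Alexandroff space if the intersection of every family of open sets is open; then $V(x)$ is the smallest open set containing $x$. For $x\in X$ and $U\subseteq X$ put $D(x,U)=\{k\in\mathbb{N}: f^k(x)\in U\}$. A point $x$ is periodic if $f^k(x)=x$ for some $k\in\mathbb{Z}^+$, and eventually periodic if $f^k(x)$ is periodic for some $k\in\mathbb{N}$. A point $x$ is quasi-periodic if for every neighborhood $U$ of $x$ there exists $m\in\mathbb{Z}^+$ such that $m\mathbb{N}\subseteq D(x,U)$. A point $x$ is recurrent if $D(x,U)$ is infinite for every neighborhood $U$ of $x$. *)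

theory Defs
  imports "HOL-Analysis.Abstract_Topology"
begin

(* The intersection with topspace X only matters for the empty family, whose
   intersection is understood relative to X. *)
definition alexandroff_space :: "'a topology \<Rightarrow> bool" where
  "alexandroff_space X \<longleftrightarrow>
     (\<forall>\<U>. (\<forall>U\<in>\<U>. openin X U) \<longrightarrow> openin X (topspace X \<inter> \<Inter>\<U>))"

definition minimal_open :: "'a topology \<Rightarrow> 'a \<Rightarrow> 'a set" where
  "minimal_open X x = \<Inter>{U. openin X U \<and> x \<in> U}"

(* Neighborhoods need not be open. *)
definition neighborhood_of :: "'a topology \<Rightarrow> 'a \<Rightarrow> 'a set \<Rightarrow> bool" where
  "neighborhood_of X x U \<longleftrightarrow>
     U \<subseteq> topspace X \<and> (\<exists>W. openin X W \<and> x \<in> W \<and> W \<subseteq> U)"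

definition visit_times :: "('a \<Rightarrow> 'a) \<Rightarrow> 'a \<Rightarrow> 'a set \<Rightarrow> nat set" where
  "visit_times f x U = {k. (f ^^ k) x \<in> U}"

definition periodic_point :: "('a \<Rightarrow> 'a) \<Rightarrow> 'a \<Rightarrow> bool" where
  "periodic_point f x \<longleftrightarrow> (\<exists>k>0. (f ^^ k) x = x)"

definition eventually_periodic_point :: "('a \<Rightarrow> 'a) \<Rightarrow> 'a \<Rightarrow> bool" where
  "eventually_periodic_point f x \<longleftrightarrow> (\<exists>k. periodic_point f ((f ^^ k) x))"

definition quasi_periodic_point :: "'a topology \<Rightarrow> ('a \<Rightarrow> 'a) \<Rightarrow> 'a \<Rightarrow> bool" where
  "quasi_periodic_point X f x \<longleftrightarrow>
     (\<forall>U. neighborhood_of X x U \<longrightarrow> (\<exists>m>0. range (\<lambda>n. m * n) \<subseteq> visit_times f x U))"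

definition recurrent_point :: "'a topology \<Rightarrow> ('a \<Rightarrow> 'a) \<Rightarrow> 'a \<Rightarrow> bool" where
  "recurrent_point X f x \<longleftrightarrow>
     (\<forall>U. neighborhood_of X x U \<longrightarrow> infinite (visit_times f x U))"

end

theory Submission
  imports Defs
begin

text \<open>Since \<open>V(x)\<close> is itself open, \<open>f^k(x) \<in> V(x)\<close> makes the preimage of \<open>V(x)\<close> under \<open>f^k\<close>
  an open set containing \<open>x\<close>, so it contains \<open>V(x)\<close>: \<open>f^k\<close> maps \<open>V(x)\<close> into itself, and
  all times in \<open>k\<nat>\<close> are visits to \<open>V(x)\<close>. If \<open>V(x)\<close> is finite, two of these visits hit the same point.\<close>

text \<open>The defining family is allowed to be infinite, which is where the Alexandroff property
  enters. As \<open>x\<close> lies in \<open>topspace X\<close>, the whole space belongs to the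
  family, so intersecting with \<open>topspace X\<close> changes nothing.\<close>

lemma openin_minimal_open:
  assumes "alexandroff_space X" "x \<in> topspace X"
  shows "openin X (minimal_open X x)"
proof -
  have "openin X (topspace X \<inter> minimal_open X x)"
    using assms(1) by (simp add: alexandroff_space_def minimal_open_def)
  moreover have "minimal_open X x \<subseteq> topspace X"
    using assms(2) unfolding minimal_open_def by blast
  ultimately show ?thesis
    by (simp add: Int_absorb1)
qed

lemma mem_minimal_open: "x \<in> minimal_open X x"
  by (simp add: minimal_open_def)

lemma minimal_open_subset:
  assumes "openin X U" "x \<in> U"
  shows "minimal_open X x \<subseteq> U"
  using assms by (auto simp: minimal_open_def)

lemma neighborhood_of_minimal_open:
  assumes "alexandroff_space X" "x \<in> topspace X"
  shows "neighborhood_of X x (minimal_open X x)"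
  using openin_minimal_open[OF assms] mem_minimal_open openin_subset
  unfolding neighborhood_of_def by fast

lemma continuous_map_funpow:
  assumes "continuous_map X X f"
  shows "continuous_map X X (f ^^ n)"
proof (induction n)
  case (Suc n)
  then show ?case
    unfolding funpow.simps using assms by (rule continuous_map_compose)
qed (simp add: id_def)

text \<open>Kept general in \<open>g\<close> so that it can be applied to the iterate
  \<open>f ^^ k\<close>.\<close>

lemma image_minimal_open_subset:
  assumes "alexandroff_space X" "continuous_map X X g" "x \<in> topspace X"
    and "g x \<in> minimal_open X x"
  shows "g ` minimal_open X x \<subseteq> minimal_open X x"
proof -
  have "openin X {y \<in> topspace X. g y \<in> minimal_open X x}"
    by (intro openin_continuous_map_preimage[OF assms(2)] openin_minimal_open assms(1,3))
  then show ?thesis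
    using minimal_open_subset[of X _ x] assms(3,4) by blast
qed

lemma funpow_mult_mem_minimal_open:
  assumes "alexandroff_space X" "continuous_map X X f" "x \<in> topspace X"
    and "(f ^^ k) x \<in> minimal_open X x"
  shows "(f ^^ (k * n)) x \<in> minimal_open X x"
proof (induction n)
  case 0
  show ?case by (simp add: mem_minimal_open)
next
  case (Suc n)
  have "(f ^^ k) ` minimal_open X x \<subseteq> minimal_open X x"
    using assms by (intro image_minimal_open_subset continuous_map_funpow)
  \<comment> \<open>Since \<open>k * Suc n = k + k * n\<close>, one more application of
    \<open>f ^^ k\<close> leads from the \<open>n\<close>-th visit to the next.\<close>
  with Suc show ?case
    by (auto simp: funpow_add)
qed

text \<open>Every neighborhood of \<open>x\<close> contains \<open>minimal_open X x\<close>, so the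
  single choice \<open>m = k\<close> serves all of them.\<close>

lemma quasi_periodic_point_if_return:
  assumes "alexandroff_space X" "continuous_map X X f" "x \<in> topspace X"
    and "k > 0" "(f ^^ k) x \<in> minimal_open X x"
  shows "quasi_periodic_point X f x"
  unfolding quasi_periodic_point_def
proof (intro allI impI)
  fix U
  assume "neighborhood_of X x U"
  then have "minimal_open X x \<subseteq> U"
    using minimal_open_subset unfolding neighborhood_of_def by fast
  then have "range (\<lambda>n. k * n) \<subseteq> visit_times f x U"
    using funpow_mult_mem_minimal_open[OF assms(1-3,5)] by (auto simp: visit_times_def)
  with \<open>k > 0\<close> show "\<exists>m>0. range (\<lambda>n. m * n) \<subseteq> visit_times f x U"
    by blast
qed

text \<open>Pigeonhole, with no topology involved: infinitely many times land in finitely many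
  points, so two times \<open>i < j\<close> give the same point, and \<open>(f ^^ i) x\<close>
  returns to itself after \<open>j - i\<close> steps.\<close>

lemma eventually_periodic_point_if_finite_visited:
  assumes "infinite (visit_times f x U)" "finite U"
  shows "eventually_periodic_point f x"
proof -
  have "(\<lambda>n. (f ^^ n) x) ` visit_times f x U \<subseteq> U"
    by (auto simp: visit_times_def)
  then have "\<not> inj_on (\<lambda>n. (f ^^ n) x) (visit_times f x U)"
    using assms inj_on_finite by blast
  then obtain i j where "i < j" and eq: "(f ^^ i) x = (f ^^ j) x"
    unfolding inj_on_def by (metis linorder_neqE_nat)
  then have "(f ^^ (j - i)) ((f ^^ i) x) = (f ^^ i) x"
    by (metis comp_apply funpow_add le_add_diff_inverse2 less_imp_le)
  with \<open>i < j\<close> show ?thesis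
    unfolding eventually_periodic_point_def periodic_point_def
    by (metis zero_less_diff)
qed

lemma infinite_visit_times_minimal_open:
  assumes "alexandroff_space X" "continuous_map X X f" "x \<in> topspace X"
    and "k > 0" "(f ^^ k) x \<in> minimal_open X x"
  shows "infinite (visit_times f x (minimal_open X x))"
proof -
  have "range (\<lambda>n. k * n) \<subseteq> visit_times f x (minimal_open X x)"
    using funpow_mult_mem_minimal_open[OF assms(1-3,5)] by (auto simp: visit_times_def)
  \<comment> \<open>Multiplication by \<open>k\<close> is injective because
    \<open>k > 0\<close>.\<close>
  moreover have "infinite (range (\<lambda>n. k * n))"
    using \<open>k > 0\<close> by (intro range_inj_infinite) (simp add: inj_def)
  ultimately show ?thesis
    using finite_subset by blast
qed

text \<open>Recurrence is applied to the neighborhood \<open>minimal_open X x\<close>; this reduces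
  the claims on recurrent points to those on returning points.\<close>

lemma return_if_recurrent_point:
  assumes "alexandroff_space X" "x \<in> topspace X" "recurrent_point X f x"
  shows "\<exists>k>0. (f ^^ k) x \<in> minimal_open X x"
proof -
  have "infinite (visit_times f x (minimal_open X x))"
    using assms(3) neighborhood_of_minimal_open[OF assms(1,2)] by (simp add: recurrent_point_def)
  \<comment> \<open>Time 0 is always a visit; an infinite set of times also has a member beyond
    0.\<close>
  then obtain k where "k > 0" "k \<in> visit_times f x (minimal_open X x)"
    by (meson infinite_nat_iff_unbounded)
  then show ?thesis
    by (auto simp: visit_times_def)
qed

theorem theorem1:
  fixes X :: "'a topology" and f :: "'a \<Rightarrow> 'a" and x :: 'a
  assumes "alexandroff_space X"
    and "continuous_map X X f"
    and "x \<in> topspace X"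
  shows "((\<exists>k>0. (f ^^ k) x \<in> minimal_open X x) \<longrightarrow> quasi_periodic_point X f x) \<and>
    ((\<exists>k>0. (f ^^ k) x \<in> minimal_open X x) \<and> finite (minimal_open X x)
        \<longrightarrow> eventually_periodic_point f x) \<and>
    (recurrent_point X f x \<longrightarrow> quasi_periodic_point X f x) \<and>
    (recurrent_point X f x \<and> finite (minimal_open X x) \<longrightarrow> eventually_periodic_point f x)"
  using quasi_periodic_point_if_return[OF assms]
    infinite_visit_times_minimal_open[OF assms]
    eventually_periodic_point_if_finite_visited[of f x "minimal_open X x"]
    return_if_recurrent_point[OF assms(1,3)]
  by blast

end
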